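(* Suppose $U\subset\mathbb R$ is compact, convex, and contains the origin, and $q^i_*$ is twice continuously differentiable in $u$ for each $i$. If the compatibility gap satisfies the global bound $$\sup_{(t,x,u)\in[0,T]\times\mathbb R^N\times U^N}|\Delta^{ij}(t,x,u)|\le\varepsilon,\qquad\forall i\neq j,$$ then for each $(t,x)\in[0,T]\times\mathbb R^N$ there exists a joint probability density $\hat\psi(\cdot;t,x)$ on $U^N$ such that: (1) The conditional densities $\hat\pi^i(\cdot\mid u^{-i};t,x)$ of $\hat\psi(\cdot;t,x)$ satisfy $$D_{\mathrm{KL}}\big(\hat\pi^i(\cdot\mid u^{-i};t,x)\,\|\,\pi^i_*(\cdot\mid u^{-i};t,x)\big)\le(e^\delta-1)^2,\qquad\forall i,\ u^{-i},\ (t,x),$$ where $\delta:=2(N-1)\varepsilon|U|^2$. For $\delta\le1$ (equivalently $\varepsilon\le\frac1{2(N-1)|U|^2}$) this simplifies to $$D_{\mathrm{KL}}\big(\hat\pi^i(\cdot\mid u^{-i};t,x)\,\|\,\pi^i_*(\cdot\mid u^{-i};t,x)\big)\le16(N-1)^2\varepsilon^2|U|^4,\qquad\forall (t,x).$$ (2) Define the uniform local Hamiltonian loss of the frozen one-player response problem $$\varepsilon^i_{\mathrm{loc}}:=\sup_{(t,x,u^{-i})}\gamma^iD_{\mathrm{KL}}\big(\hat\pi^i(\cdot\mid u^{-i};t,x)\,\|\,\pi^i_*(\cdot\mid u^{-i};t,x)\big).$$ Then $\varepsilon^i_{\mathrm{loc}}\le\gamma^i(e^\delta-1)^2$, and for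 $\delta\le1$, $\varepsilon^i_{\mathrm{loc}}\le16\gamma^i(N-1)^2\varepsilon^2|U|^4$. When $\varepsilon=0$, $\hat\psi$ realizes all frozen Gibbs conditionals exactly, i.e. $\hat\pi^i=\pi^i_*$ for all $i$.
   Context: Setting. $N\in\mathbb N$ is the number of players, $T>0$ the horizon, $U\subset\mathbb R$ the (scalar) action set, $|U|>0$ its Lebesgue measure. For $u\in U^N$, $u^{-i}\in U^{N-1}$ is $u$ with coordinate $u^i$ deleted. Data: measurable $b^k,\sigma^k:[0,T]\times\mathbb R^N\times U^N\to\mathbb R$, running rewards $f^i:[0,T]\times\mathbb R^N\times U\to\mathbb R$, terminal rewards $g^i:\mathbb R^N\to\mathbb R$, discount rates $\beta^i\ge0$, exploration weights $\gamma^i>0$. Hamiltonian: $H^i(t,x,u,p,A)=\sum_{k=1}^N[b^k(t,x,u)p^k+\tfrac12\sigma^k(t,x,u)^2A^{k,k}]+f^i(t,x,u^i)$. Frozen value: for fixed $u^{-i}$, $\tilde V^i(t,x;u^{-i})$ is the value function of player $i$'s entropy-regularized single-agent control problem with the opponents' actions frozen at $u^{-i}$ on the whole remaining horizon. It is assumed to be a classical ($C^{1,2}$ in $(t,x)$) solution of $$0=\partial_t\tilde V^i-\beta^i\tilde V^i+\gamma^i\log\int_U\exp\Big\{\tfrac1{\gamma^i}H^i(t,x,u^i,u^{-i},\partial_x\tilde V^i,\partial_x^2\tilde V^i)\Big\}du^i,\qquad \tilde V^i(T,x;u^{-i})=g^i(x).$$ Optimal $q$-function: $q^i_*(t,x,u)=\partial_t\tilde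 V^i+H^i(t,x,u,\partial_x\tilde V^i,\partial_x^2\tilde V^i)-\beta^i\tilde V^i$, derivatives of $\tilde V^i$ at $(t,x;u^{-i})$. Frozen Gibbs response (conditional): $\pi^i_*(u^i\mid u^{-i};t,x)=\dfrac{\exp\{H^i(t,x,u,\partial_x\tilde V^i,\partial_x^2\tilde V^i)/\gamma^i\}}{\int_U\exp\{H^i(t,x,z^i,u^{-i},\partial_x\tilde V^i,\partial_x^2\tilde V^i)/\gamma^i\}dz^i}$, which by the HJB equation equals $\exp\{q^i_*(t,x,u)/\gamma^i\}$. Compatibility gap: $\Delta^{ij}(t,x,u):=\dfrac1{\gamma^i}\dfrac{\partial^2q^i_*}{\partial u^j\partial u^i}(t,x,u)-\dfrac1{\gamma^j}\dfrac{\partial^2q^j_*}{\partial u^i\partial u^j}(t,x,u)$, $i\neq j$. $D_{\mathrm{KL}}(\mu\|\nu)=\int_U\mu\log(\mu/\nu)\,du^i$ for densities on $U$. The conditional density of $\hat\psi$ is $\hat\pi^i(u^i\mid u^{-i};t,x)=\hat\psi(u;t,x)/\int_U\hat\psi(z^i,u^{-i};t,x)dz^i$. *)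

theory Defs
  imports "HOL-Analysis.Analysis"
begin

text \<open>
  Players are the elements of a finite type, so that \<open>N = CARD('n)\<close>; states and action
  profiles are vectors in \<open>real ^ 'n\<close>.  An opponents' profile \<open>u\<^sup>-\<^sup>i\<close> is an extensional function on
  \<open>- {i}\<close>, hence it carries no information about coordinate \<open>i\<close>.
\<close>

definition cube :: "real set \<Rightarrow> (real ^ 'n) set" where
  "cube U = {u. \<forall>i. u $ i \<in> U}"

definition opponents :: "real set \<Rightarrow> 'n \<Rightarrow> ('n \<Rightarrow> real) set" where
  "opponents U i = (- {i}) \<rightarrow>\<^sub>E U"

definition others :: "'n \<Rightarrow> real ^ 'n \<Rightarrow> 'n \<Rightarrow> real" where
  "others i u = restrict (($) u) (- {i})"

definition profile :: "'n \<Rightarrow> real \<Rightarrow> ('n \<Rightarrow> real) \<Rightarrow> real ^ 'n" where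
  "profile i a v = (\<chi> j. if j = i then a else v j)"


text \<open>
  Partial derivatives with the moving coordinate confined to \<open>S\<close>: one-sided at the end points when
  \<open>S\<close> is an interval, ordinary partial derivatives when \<open>S = UNIV\<close>.
\<close>

definition has_partial :: "real set \<Rightarrow> 'n \<Rightarrow> (real ^ 'n \<Rightarrow> real) \<Rightarrow> real ^ 'n \<Rightarrow> bool" where
  "has_partial S k F x \<longleftrightarrow>
     (\<lambda>s. F (profile k s (others k x))) differentiable (at (x $ k) within S)"

definition partial :: "real set \<Rightarrow> 'n \<Rightarrow> (real ^ 'n \<Rightarrow> real) \<Rightarrow> real ^ 'n \<Rightarrow> real" where
  "partial S k F x =
     vector_derivative (\<lambda>s. F (profile k s (others k x))) (at (x $ k) within S)"

definition C2_on_cube :: "real set \<Rightarrow> (real ^ 'n \<Rightarrow> real) \<Rightarrow> bool" where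
  "C2_on_cube U F \<longleftrightarrow>
     continuous_on (cube U) F \<and>
     (\<forall>k. (\<forall>u\<in>cube U. has_partial U k F u) \<and> continuous_on (cube U) (partial U k F)) \<and>
     (\<forall>k l. (\<forall>u\<in>cube U. has_partial U l (partial U k F) u) \<and>
            continuous_on (cube U) (partial U l (partial U k F)))"

definition time_deriv :: "real \<Rightarrow> (real \<Rightarrow> real ^ 'n \<Rightarrow> real) \<Rightarrow> real \<Rightarrow> real ^ 'n \<Rightarrow> real" where
  "time_deriv T W t x = vector_derivative (\<lambda>s. W s x) (at t within {0..T})"

definition space_grad :: "(real \<Rightarrow> real ^ 'n \<Rightarrow> real) \<Rightarrow> real \<Rightarrow> real ^ 'n \<Rightarrow> real ^ 'n" where
  "space_grad W t x = (\<chi> k. partial UNIV k (W t) x)"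

definition space_hess :: "(real \<Rightarrow> real ^ 'n \<Rightarrow> real) \<Rightarrow> real \<Rightarrow> real ^ 'n \<Rightarrow> real ^ 'n ^ 'n" where
  "space_hess W t x = (\<chi> k l. partial UNIV k (partial UNIV l (W t)) x)"

definition C12 :: "real \<Rightarrow> (real \<Rightarrow> real ^ 'n \<Rightarrow> real) \<Rightarrow> bool" where
  "C12 T W \<longleftrightarrow>
     (\<forall>t\<in>{0..T}. \<forall>x. (\<lambda>s. W s x) differentiable (at t within {0..T}) \<and>
        (\<forall>k. has_partial UNIV k (W t) x) \<and>
        (\<forall>k l. has_partial UNIV k (partial UNIV l (W t)) x)) \<and>
     continuous_on ({0..T} \<times> UNIV) (\<lambda>(t, x). W t x) \<and>
     continuous_on ({0..T} \<times> UNIV) (\<lambda>(t, x). time_deriv T W t x) \<and>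
     continuous_on ({0..T} \<times> UNIV) (\<lambda>(t, x). space_grad W t x) \<and>
     continuous_on ({0..T} \<times> UNIV) (\<lambda>(t, x). space_hess W t x)"


definition measurable_data ::
  "real \<Rightarrow> real set \<Rightarrow> ('n \<Rightarrow> real \<Rightarrow> real ^ 'n \<Rightarrow> real ^ 'n \<Rightarrow> real) \<Rightarrow>
   ('n \<Rightarrow> real \<Rightarrow> real ^ 'n \<Rightarrow> real ^ 'n \<Rightarrow> real) \<Rightarrow> ('n \<Rightarrow> real \<Rightarrow> real ^ 'n \<Rightarrow> real \<Rightarrow> real) \<Rightarrow>
   ('n \<Rightarrow> real ^ 'n \<Rightarrow> real) \<Rightarrow> bool" where
  "measurable_data T U b \<sigma> f g \<longleftrightarrow>
     (\<forall>k. (\<lambda>(t, x, u). b k t x u)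
            \<in> borel_measurable (restrict_space borel ({0..T} \<times> UNIV \<times> cube U)) \<and>
          (\<lambda>(t, x, u). \<sigma> k t x u)
            \<in> borel_measurable (restrict_space borel ({0..T} \<times> UNIV \<times> cube U)) \<and>
          (\<lambda>(t, x, a). f k t x a)
            \<in> borel_measurable (restrict_space borel ({0..T} \<times> UNIV \<times> U)) \<and>
          g k \<in> borel_measurable borel)"

definition hamiltonian ::
  "('n \<Rightarrow> real \<Rightarrow> real ^ 'n \<Rightarrow> real ^ 'n \<Rightarrow> real) \<Rightarrow>
   ('n \<Rightarrow> real \<Rightarrow> real ^ 'n \<Rightarrow> real ^ 'n \<Rightarrow> real) \<Rightarrow> ('n \<Rightarrow> real \<Rightarrow> real ^ 'n \<Rightarrow> real \<Rightarrow> real) \<Rightarrow>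
   'n \<Rightarrow> real \<Rightarrow> real ^ 'n \<Rightarrow> real ^ 'n \<Rightarrow> real ^ 'n \<Rightarrow> real ^ 'n ^ 'n \<Rightarrow> real" where
  "hamiltonian b \<sigma> f i t x u p A =
     (\<Sum>k\<in>UNIV. b k t x u * p $ k + 1 / 2 * (\<sigma> k t x u)\<^sup>2 * A $ k $ k) + f i t x (u $ i)"

text \<open>
  The integrability conjunct makes the integral in the equation meaningful, since the Bochner
  integral of a non-integrable function is \<open>0\<close> (and \<open>ln 0 = 0\<close>).  It is automatic when the
  Hamiltonian is continuous in the player's own action on a compact \<open>U\<close>.
\<close>

definition classical_HJB_solution ::
  "real \<Rightarrow> real set \<Rightarrow> ('n \<Rightarrow> real \<Rightarrow> real ^ 'n \<Rightarrow> real ^ 'n \<Rightarrow> real) \<Rightarrow>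
   ('n \<Rightarrow> real \<Rightarrow> real ^ 'n \<Rightarrow> real ^ 'n \<Rightarrow> real) \<Rightarrow> ('n \<Rightarrow> real \<Rightarrow> real ^ 'n \<Rightarrow> real \<Rightarrow> real) \<Rightarrow>
   ('n \<Rightarrow> real ^ 'n \<Rightarrow> real) \<Rightarrow> ('n \<Rightarrow> real) \<Rightarrow> ('n \<Rightarrow> real) \<Rightarrow>
   'n \<Rightarrow> ('n \<Rightarrow> real) \<Rightarrow> (real \<Rightarrow> real ^ 'n \<Rightarrow> real) \<Rightarrow> bool" where
  "classical_HJB_solution T U b \<sigma> f g \<beta> \<gamma> i v W \<longleftrightarrow>
     C12 T W \<and>
     (\<forall>t\<in>{0..T}. \<forall>x.
        set_integrable lborel U (\<lambda>a. exp (1 / \<gamma> i *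
          hamiltonian b \<sigma> f i t x (profile i a v) (space_grad W t x) (space_hess W t x))) \<and>
        0 = time_deriv T W t x - \<beta> i * W t x +
            \<gamma> i * ln (LINT a:U|lborel. exp (1 / \<gamma> i *
              hamiltonian b \<sigma> f i t x (profile i a v) (space_grad W t x) (space_hess W t x)))) \<and>
     (\<forall>x. W T x = g i x)"

text \<open>
  Below, \<open>V i v\<close> is the frozen value of player \<open>i\<close> against \<open>v \<in> opponents U i\<close>, as a function of
  \<open>(t, x)\<close>.
\<close>

definition q_star ::
  "real \<Rightarrow> ('n \<Rightarrow> real \<Rightarrow> real ^ 'n \<Rightarrow> real ^ 'n \<Rightarrow> real) \<Rightarrow>
   ('n \<Rightarrow> real \<Rightarrow> real ^ 'n \<Rightarrow> real ^ 'n \<Rightarrow> real) \<Rightarrow> ('n \<Rightarrow> real \<Rightarrow> real ^ 'n \<Rightarrow> real \<Rightarrow> real) \<Rightarrow>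
   ('n \<Rightarrow> real) \<Rightarrow> ('n \<Rightarrow> ('n \<Rightarrow> real) \<Rightarrow> real \<Rightarrow> real ^ 'n \<Rightarrow> real) \<Rightarrow>
   'n \<Rightarrow> real \<Rightarrow> real ^ 'n \<Rightarrow> real ^ 'n \<Rightarrow> real" where
  "q_star T b \<sigma> f \<beta> V i t x u =
     (let W = V i (others i u) in
        time_deriv T W t x
        + hamiltonian b \<sigma> f i t x u (space_grad W t x) (space_hess W t x)
        - \<beta> i * W t x)"

definition gibbs_response ::
  "real set \<Rightarrow> ('n \<Rightarrow> real \<Rightarrow> real ^ 'n \<Rightarrow> real ^ 'n \<Rightarrow> real) \<Rightarrow>
   ('n \<Rightarrow> real \<Rightarrow> real ^ 'n \<Rightarrow> real ^ 'n \<Rightarrow> real) \<Rightarrow> ('n \<Rightarrow> real \<Rightarrow> real ^ 'n \<Rightarrow> real \<Rightarrow> real) \<Rightarrow>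
   ('n \<Rightarrow> real) \<Rightarrow> ('n \<Rightarrow> ('n \<Rightarrow> real) \<Rightarrow> real \<Rightarrow> real ^ 'n \<Rightarrow> real) \<Rightarrow>
   'n \<Rightarrow> real \<Rightarrow> real ^ 'n \<Rightarrow> ('n \<Rightarrow> real) \<Rightarrow> real \<Rightarrow> real" where
  "gibbs_response U b \<sigma> f \<gamma> V i t x v a =
     (let h = (\<lambda>z. hamiltonian b \<sigma> f i t x (profile i z v)
                     (space_grad (V i v) t x) (space_hess (V i v) t x))
      in exp (h a / \<gamma> i) / (LINT z:U|lborel. exp (h z / \<gamma> i)))"

definition compat_gap ::
  "real \<Rightarrow> real set \<Rightarrow> ('n \<Rightarrow> real \<Rightarrow> real ^ 'n \<Rightarrow> real ^ 'n \<Rightarrow> real) \<Rightarrow>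
   ('n \<Rightarrow> real \<Rightarrow> real ^ 'n \<Rightarrow> real ^ 'n \<Rightarrow> real) \<Rightarrow> ('n \<Rightarrow> real \<Rightarrow> real ^ 'n \<Rightarrow> real \<Rightarrow> real) \<Rightarrow>
   ('n \<Rightarrow> real) \<Rightarrow> ('n \<Rightarrow> real) \<Rightarrow> ('n \<Rightarrow> ('n \<Rightarrow> real) \<Rightarrow> real \<Rightarrow> real ^ 'n \<Rightarrow> real) \<Rightarrow>
   'n \<Rightarrow> 'n \<Rightarrow> real \<Rightarrow> real ^ 'n \<Rightarrow> real ^ 'n \<Rightarrow> real" where
  "compat_gap T U b \<sigma> f \<beta> \<gamma> V i j t x u =
     1 / \<gamma> i * partial U j (partial U i (q_star T b \<sigma> f \<beta> V i t x)) u
     - 1 / \<gamma> j * partial U i (partial U j (q_star T b \<sigma> f \<beta> V j t x)) u"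


definition prob_density_on :: "'a::euclidean_space set \<Rightarrow> ('a \<Rightarrow> real) \<Rightarrow> bool" where
  "prob_density_on S p \<longleftrightarrow>
     (\<forall>x\<in>S. 0 \<le> p x) \<and> set_integrable lborel S p \<and> (LINT x:S|lborel. p x) = 1"

definition cond_density ::
  "real set \<Rightarrow> (real ^ 'n \<Rightarrow> real) \<Rightarrow> 'n \<Rightarrow> ('n \<Rightarrow> real) \<Rightarrow> real \<Rightarrow> real" where
  "cond_density U \<psi> i v a = \<psi> (profile i a v) / (LINT z:U|lborel. \<psi> (profile i z v))"

text \<open>
  Extended-real valued, so that a divergent integral or a failure of absolute continuity gives
  \<open>\<infinity>\<close> instead of the totalised values \<open>0\<close> of the Bochner integral, of \<open>/ 0\<close> and of \<open>ln 0\<close>.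
\<close>

definition KL_density :: "real set \<Rightarrow> (real \<Rightarrow> real) \<Rightarrow> (real \<Rightarrow> real) \<Rightarrow> ereal" where
  "KL_density U \<mu> \<nu> =
     (if (AE a in lborel. a \<in> U \<longrightarrow> \<nu> a = 0 \<longrightarrow> \<mu> a = 0) \<and>
         set_integrable lborel U (\<lambda>a. \<mu> a * ln (\<mu> a / \<nu> a))
      then ereal (LINT a:U|lborel. \<mu> a * ln (\<mu> a / \<nu> a))
      else \<infinity>)"

definition local_loss ::
  "real \<Rightarrow> real set \<Rightarrow> ('n \<Rightarrow> real \<Rightarrow> real ^ 'n \<Rightarrow> real ^ 'n \<Rightarrow> real) \<Rightarrow>
   ('n \<Rightarrow> real \<Rightarrow> real ^ 'n \<Rightarrow> real ^ 'n \<Rightarrow> real) \<Rightarrow> ('n \<Rightarrow> real \<Rightarrow> real ^ 'n \<Rightarrow> real \<Rightarrow> real) \<Rightarrow>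
   ('n \<Rightarrow> real) \<Rightarrow> ('n \<Rightarrow> ('n \<Rightarrow> real) \<Rightarrow> real \<Rightarrow> real ^ 'n \<Rightarrow> real) \<Rightarrow>
   (real \<Rightarrow> real ^ 'n \<Rightarrow> real ^ 'n \<Rightarrow> real) \<Rightarrow> 'n \<Rightarrow> ereal" where
  "local_loss T U b \<sigma> f \<gamma> V \<psi> i =
     (SUP (t, x, v) \<in> {0..T} \<times> UNIV \<times> opponents U i.
        ereal (\<gamma> i) *
        KL_density U (cond_density U (\<psi> t x) i v) (gibbs_response U b \<sigma> f \<gamma> V i t x v))"

end

theory Submission
  imports Defs
begin

text \<open>
  Fix \<open>(t, x)\<close>.  The frozen response of player \<open>i\<close> is the Gibbs density of
  \<open>h\<^sub>i = q\<^sub>i / \<gamma>\<^sub>i\<close>, because \<open>q\<^sub>i\<close> and the Hamiltonian differ by a term that does not depend on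
  \<open>u\<^sub>i\<close>.  Let \<open>\<Phi>\<close> be the integral of the form \<open>\<Sum>k. \<partial>\<^sub>kh\<^sub>k du\<^sub>k\<close> along the coordinate path from
  \<open>0\<close> to \<open>u\<close>, and let \<open>\<psi>\<close> be the Gibbs density of \<open>\<Phi>\<close>.  The gap bounds the curl of the form: for
  each \<open>k \<noteq> i\<close> the mixed second differences of \<open>h\<^sub>i\<close> and \<open>h\<^sub>k\<close> over a rectangle differ by at most
  \<open>\<epsilon>\<close> times its area.  Hence the oscillation of \<open>\<Phi> - h\<^sub>i\<close> in \<open>u\<^sub>i\<close> is at most
  \<open>D = (N - 1) \<epsilon> \<bar>U\<bar>\<^sup>2 = \<delta> / 2\<close>, the conditional densities of \<open>\<psi>\<close> and the frozen responses agree up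
  to a factor \<open>exp D\<close>, and their divergence is at most \<open>(exp D - 1)\<^sup>2\<close>.
\<close>

subsection \<open>Gibbs densities on compact sets\<close>

definition gibbs :: "'a::euclidean_space set \<Rightarrow> ('a \<Rightarrow> real) \<Rightarrow> 'a \<Rightarrow> real" where
  "gibbs S h a = exp (h a) / (LINT z:S|lborel. exp (h z))"

lemma set_integrable_compact:
  fixes f :: "'a::euclidean_space \<Rightarrow> 'b::{banach, second_countable_topology}"
  assumes "compact S" "continuous_on S f"
  shows "set_integrable lborel S f"
  using borel_integrable_compact[OF assms] by (simp add: set_integrable_def)

lemma set_integral_pos_compact:
  fixes f :: "'a::euclidean_space \<Rightarrow> real"
  assumes S: "compact S" "0 < measure lborel S"
    and f: "continuous_on S f" "\<And>x. x \<in> S \<Longrightarrow> 0 < f x"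
  shows "0 < (LINT x:S|lborel. f x)"
proof -
  have "S \<noteq> {}" using S by auto
  then obtain m where m: "m \<in> S" "\<And>x. x \<in> S \<Longrightarrow> f m \<le> f x"
    using continuous_attains_inf[OF S(1) _ f(1)] by blast
  \<comment> \<open>\<open>measure\<close> sends an infinite measure to 0, so its positivity
    excludes that case.\<close>
  have "emeasure lborel S \<noteq> \<infinity>"
    using emeasure_lborel_cbox_finite S(2) by (metis enn2real_top infinity_ennreal_def less_irrefl measure_def)
  then have const: "(LINT x:S|lborel. f m) = f m * measure lborel S"
    using S(1) by (subst set_integral_const) (auto simp: compact_imp_closed)
  have "0 < f m * measure lborel S" using f(2) m(1) S(2) by simp
  also have "\<dots> \<le> (LINT x:S|lborel. f x)"
    unfolding const[symmetric]
    by (rule set_integral_mono) (use m S f in \<open>auto intro!: set_integrable_compact\<close>)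
  finally show ?thesis .
qed

context
  fixes S :: "'a::euclidean_space set"
  assumes S: "compact S" "0 < measure lborel S"
begin

lemma partition_function_pos:
  fixes h :: "'a \<Rightarrow> real"
  assumes "continuous_on S h"
  shows "0 < (LINT z:S|lborel. exp (h z))"
  by (rule set_integral_pos_compact[OF S]) (simp_all add: continuous_on_exp assms)

lemma gibbs_pos:
  assumes "continuous_on S h"
  shows "0 < gibbs S h a"
  using partition_function_pos[OF assms] by (simp add: gibbs_def)

lemma continuous_on_gibbs:
  assumes "continuous_on S h"
  shows "continuous_on S (gibbs S h)"
  unfolding gibbs_def
  by (intro continuous_intros assms) (use partition_function_pos[OF assms] in simp)

lemma prob_density_on_gibbs:
  assumes "continuous_on S h"
  shows "prob_density_on S (gibbs S h)"
proof -
  have "(LINT a:S|lborel. gibbs S h a) = 1"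
    using partition_function_pos[OF assms] by (simp add: gibbs_def)
  then show ?thesis
    using gibbs_pos[OF assms] set_integrable_compact[OF S(1) continuous_on_gibbs[OF assms]]
    by (simp add: prob_density_on_def less_imp_le)
qed

text \<open>Integrating \<open>exp (h a - k a - D) * exp (k z) \<le> exp (h z)\<close> over
  \<open>z\<close> compares the partition functions. Because the hypothesis bounds an oscillation,
  additive constants cancel and the factor is \<open>exp D\<close>; a sup-norm bound
  \<open>D\<close> on \<open>h - k\<close> would cost \<open>exp (2 * D)\<close>.\<close>

lemma gibbs_le_gibbs:
  fixes h k :: "'a \<Rightarrow> real"
  assumes h: "continuous_on S h" and k: "continuous_on S k"
    and osc: "\<And>z. z \<in> S \<Longrightarrow> (h a - k a) - (h z - k z) \<le> D"
  shows "gibbs S h a \<le> exp D * gibbs S k a"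
proof -
  have "exp (h a - k a - D) * (LINT z:S|lborel. exp (k z)) = (LINT z:S|lborel. exp (h a - k a - D) * exp (k z))"
    by simp
  also have "\<dots> \<le> (LINT z:S|lborel. exp (h z))"
  proof (rule set_integral_mono)
    show "exp (h a - k a - D) * exp (k z) \<le> exp (h z)" if "z \<in> S" for z
      using osc[OF that] by (simp flip: exp_add)
  qed (intro set_integrable_compact continuous_intros h k S)+
  finally show ?thesis
    using partition_function_pos[OF h] partition_function_pos[OF k]
    by (simp add: gibbs_def field_simps exp_diff exp_add)
qed

end

lemma gibbs_add_const:
  "gibbs S (\<lambda>z. h z + c) = gibbs S h"
  by (rule ext) (simp add: gibbs_def exp_add)

text \<open>The Kullback--Leibler divergence is at most the chi-squared divergence, and the density
  ratio lies in \<open>[exp (- D), exp D]\<close>.\<close>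

lemma KL_gibbs_le:
  fixes h k :: "real \<Rightarrow> real"
  assumes U: "compact U" "0 < measure lborel U"
    and h: "continuous_on U h" and k: "continuous_on U k"
    and osc: "\<And>a z. a \<in> U \<Longrightarrow> z \<in> U \<Longrightarrow> \<bar>(h a - k a) - (h z - k z)\<bar> \<le> D"
  shows "KL_density U (gibbs U h) (gibbs U k) \<le> ereal ((exp D - 1)\<^sup>2)"
proof -
  let ?\<mu> = "gibbs U h" and ?\<nu> = "gibbs U k"
  note pos = gibbs_pos[OF U h] gibbs_pos[OF U k]
  have nz: "?\<mu> a \<noteq> 0" "?\<nu> a \<noteq> 0" for a using pos[of a] by auto
  have \<mu>: "continuous_on U ?\<mu>" and \<nu>: "continuous_on U ?\<nu>"
    by (rule continuous_on_gibbs[OF U], fact)+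
  have int: "(LINT a:U|lborel. ?\<mu> a) = 1" "(LINT a:U|lborel. ?\<nu> a) = 1"
    using prob_density_on_gibbs[OF U h] prob_density_on_gibbs[OF U k]
    by (auto simp: prob_density_on_def)
  have intgbl: "set_integrable lborel U ?\<mu>" "set_integrable lborel U ?\<nu>"
    by (intro set_integrable_compact U \<mu> \<nu>)+
  have KL: "set_integrable lborel U (\<lambda>a. ?\<mu> a * ln (?\<mu> a / ?\<nu> a))"
    by (intro set_integrable_compact U continuous_intros \<mu> \<nu>) (simp_all add: nz)
  \<comment> \<open>The extra term \<open>?\<mu> a - ?\<nu> a\<close> integrates to 0, since both
    densities have mass 1.\<close>
  have ptw: "?\<mu> a * ln (?\<mu> a / ?\<nu> a) \<le> (exp D - 1)\<^sup>2 * ?\<nu> a + (?\<mu> a - ?\<nu> a)" if a: "a \<in> U" for a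
  proof -
    define r where "r = ?\<mu> a / ?\<nu> a"
    have r: "?\<mu> a = r * ?\<nu> a" "0 < r" using pos[of a] by (auto simp: r_def)
    have "r \<le> exp D"
      using gibbs_le_gibbs[OF U h k, of a D] osc[OF a] pos[of a]
      by (fastforce simp: r_def field_simps)
    moreover have "exp (- D) \<le> r"
    proof -
      have "?\<nu> a \<le> exp D * ?\<mu> a"
        by (rule gibbs_le_gibbs[OF U k h]) (use osc[OF a] in fastforce)
      then show ?thesis using pos[of a] by (simp add: r_def exp_minus field_simps)
    qed
    \<comment> \<open>This gives \<open>1 - exp (- D) \<le> exp D - 1\<close>, so the deviation of
      \<open>r\<close> below 1 obeys the same bound as the one above.\<close>
    moreover have "2 \<le> exp D + exp (- D)"
    proof -
      have "0 \<le> (exp (D/2) - exp (-D/2))\<^sup>2" by simp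
      also have "\<dots> = exp D + exp (- D) - 2"
        by (simp add: power2_diff flip: exp_double exp_add)
      finally show ?thesis by simp
    qed
    ultimately have "\<bar>r - 1\<bar> \<le> exp D - 1"
      by linarith
    then have sq: "(r - 1)\<^sup>2 \<le> (exp D - 1)\<^sup>2"
      by (metis abs_ge_zero power2_abs power_mono)
    have "?\<mu> a * ln r \<le> ?\<mu> a * (r - 1)"
      using pos[of a] r ln_le_minus_one by simp
    also have "\<dots> = (r - 1)\<^sup>2 * ?\<nu> a + (?\<mu> a - ?\<nu> a)"
      unfolding r(1) by (simp add: power2_eq_square algebra_simps)
    also have "\<dots> \<le> (exp D - 1)\<^sup>2 * ?\<nu> a + (?\<mu> a - ?\<nu> a)"
      using sq pos[of a] by (simp add: mult_right_mono)
    finally show ?thesis by (simp add: r_def)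
  qed
  have "(LINT a:U|lborel. ?\<mu> a * ln (?\<mu> a / ?\<nu> a))
      \<le> (LINT a:U|lborel. (exp D - 1)\<^sup>2 * ?\<nu> a + (?\<mu> a - ?\<nu> a))"
    by (rule set_integral_mono[OF KL]) (use ptw intgbl in auto)
  also have "\<dots> = (exp D - 1)\<^sup>2"
    using intgbl by (simp add: int)
  finally show ?thesis
    using KL nz by (simp add: KL_density_def)
qed

subsection \<open>Mixed second differences\<close>

text \<open>The fundamental theorem is applied in \<open>r\<close>, then in \<open>s\<close>; the
  gauge integral integrates every derivative on an interval.\<close>

lemma mixed_difference_eq_integral:
  fixes p ps psr :: "real \<Rightarrow> real \<Rightarrow> real"
  assumes le: "a \<le> b" "c \<le> d"
    and ps: "\<And>s r. s \<in> {a..b} \<Longrightarrow> r \<in> {c..d} \<Longrightarrow>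
      ((\<lambda>s. p s r) has_vector_derivative ps s r) (at s within {a..b})"
    and psr: "\<And>s r. s \<in> {a..b} \<Longrightarrow> r \<in> {c..d} \<Longrightarrow>
      ((\<lambda>r. ps s r) has_vector_derivative psr s r) (at r within {c..d})"
  shows "integral {a..b} (\<lambda>s. integral {c..d} (psr s)) = p b d - p a d - p b c + p a c"
proof -
  have "((\<lambda>s. ps s d - ps s c) has_integral (p b d - p a d) - (p b c - p a c)) {a..b}"
    by (intro has_integral_diff fundamental_theorem_of_calculus le ps) (use le in auto)
  moreover have "integral {c..d} (psr s) = ps s d - ps s c" if "s \<in> {a..b}" for s
    by (intro integral_unique fundamental_theorem_of_calculus le psr that)
  ultimately have "((\<lambda>s. integral {c..d} (psr s)) has_integral (p b d - p a d) - (p b c - p a c)) {a..b}"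
    by (subst has_integral_cong) auto
  then show ?thesis by (simp add: integral_unique)
qed

text \<open>The mixed derivatives of \<open>p\<close> and \<open>q\<close> are taken in opposite orders; Fubini's theorem replaces
  the symmetry of second derivatives.\<close>

lemma mixed_difference_gap:
  fixes p ps psr q qr qrs :: "real \<Rightarrow> real \<Rightarrow> real"
  assumes le: "a \<le> b" "c \<le> d"
    and p: "\<And>s r. s \<in> {a..b} \<Longrightarrow> r \<in> {c..d} \<Longrightarrow>
      ((\<lambda>s. p s r) has_vector_derivative ps s r) (at s within {a..b})"
      "\<And>s r. s \<in> {a..b} \<Longrightarrow> r \<in> {c..d} \<Longrightarrow>
      ((\<lambda>r. ps s r) has_vector_derivative psr s r) (at r within {c..d})"
    and q: "\<And>s r. s \<in> {a..b} \<Longrightarrow> r \<in> {c..d} \<Longrightarrow>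
      ((\<lambda>r. q s r) has_vector_derivative qr s r) (at r within {c..d})"
      "\<And>s r. s \<in> {a..b} \<Longrightarrow> r \<in> {c..d} \<Longrightarrow>
      ((\<lambda>s. qr s r) has_vector_derivative qrs s r) (at s within {a..b})"
    and cont: "continuous_on (cbox (a, c) (b, d)) (\<lambda>(s, r). psr s r)"
      "continuous_on (cbox (a, c) (b, d)) (\<lambda>(s, r). qrs s r)"
    and gap: "\<And>s r. s \<in> {a..b} \<Longrightarrow> r \<in> {c..d} \<Longrightarrow> \<bar>\<kappa> * psr s r - l * qrs s r\<bar> \<le> e"
  shows "\<bar>\<kappa> * (p b d - p a d - p b c + p a c) - l * (q b d - q a d - q b c + q a c)\<bar>
    \<le> e * ((b - a) * (d - c))"
proof -
  let ?R = "cbox (a, c) (b, d)"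
  have "p b d - p a d - p b c + p a c = integral {a..b} (\<lambda>s. integral {c..d} (psr s))"
    by (rule mixed_difference_eq_integral[OF le p, symmetric])
  also have "\<dots> = integral ?R (\<lambda>(s, r). psr s r)"
    using integral_prod_continuous[OF cont(1)] by simp
  finally have P: "p b d - p a d - p b c + p a c = integral ?R (\<lambda>(s, r). psr s r)" .
  have "q b d - q b c - q a d + q a c
      = integral {c..d} (\<lambda>r. integral {a..b} (\<lambda>s. qrs s r))"
    by (rule mixed_difference_eq_integral[OF le(2,1), of "\<lambda>r s. q s r" "\<lambda>r s. qr s r", symmetric])
      (use q in auto)
  also have "\<dots> = integral {a..b} (\<lambda>s. integral {c..d} (qrs s))"
    using integral_swap_continuous[OF cont(2)] by simp
  also have "\<dots> = integral ?R (\<lambda>(s, r). qrs s r)"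
    using integral_prod_continuous[OF cont(2)] by simp
  finally have Q: "q b d - q a d - q b c + q a c = integral ?R (\<lambda>(s, r). qrs s r)" by simp
  have ig: "(\<lambda>(s, r). psr s r) integrable_on ?R" "(\<lambda>(s, r). qrs s r) integrable_on ?R"
    by (intro integrable_continuous cont)+
  have hi: "((\<lambda>z. \<kappa> * (case z of (s, r) \<Rightarrow> psr s r) - l * (case z of (s, r) \<Rightarrow> qrs s r)) has_integral
      \<kappa> * (p b d - p a d - p b c + p a c) - l * (q b d - q a d - q b c + q a c)) ?R"
    unfolding P Q
    by (intro has_integral_diff has_integral_mult_right integrable_integral ig)
  have "0 \<le> e" using gap[of a c] le by force
  then have "norm (\<kappa> * (p b d - p a d - p b c + p a c) - l * (q b d - q a d - q b c + q a c))
      \<le> e * measure lborel ?R"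
    by (rule has_integral_bound[OF _ hi]) (auto simp: cbox_Pair_eq intro!: gap)
  then show ?thesis using le by (simp add: content_Pair)
qed

section \<open>Two-dimensional coordinate slices of the cube\<close>

definition upd :: "'n \<Rightarrow> real \<Rightarrow> real ^ 'n \<Rightarrow> real ^ 'n" where
  "upd i s u = profile i s (others i u)"

lemma upd_nth: "upd i s u $ j = (if j = i then s else u $ j)"
  by (simp add: upd_def profile_def others_def)

lemma upd_in_cube: "u \<in> cube U \<Longrightarrow> s \<in> U \<Longrightarrow> upd i s u \<in> cube U"
  by (simp add: cube_def upd_nth)

lemma upd_upd: "upd i s (upd i t u) = upd i s u"
  by (simp add: vec_eq_iff upd_nth)

lemma upd_comm: "i \<noteq> k \<Longrightarrow> upd i s (upd k t u) = upd k t (upd i s u)"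
  by (auto simp add: vec_eq_iff upd_nth)

text \<open>The line through \<open>upd k s u\<close> in direction \<open>k\<close> is the same for
  every \<open>s\<close>, so a single one-variable function has \<open>partial\<close> as its
  derivative at all its points. Passing to \<open>A\<close> serves the sides of a rectangle inside
  the cube.\<close>

lemma partial_has_vector_derivative:
  assumes "has_partial U k F (upd k s u)" "A \<subseteq> U"
  shows "((\<lambda>s. F (upd k s u)) has_vector_derivative partial U k F (upd k s u)) (at s within A)"
proof -
  have eq: "profile k s' (others k (upd k s u)) = upd k s' u" for s'
    using upd_upd[of k s' s u] by (simp add: upd_def)
  have "((\<lambda>s. F (upd k s u)) has_vector_derivative partial U k F (upd k s u)) (at s within U)"
    using assms(1) unfolding has_partial_def partial_def eq
    by (simp add: upd_nth vector_derivative_works)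
  then show ?thesis using assms(2) by (rule has_vector_derivative_within_subset)
qed

lemma continuous_on_upd_upd:
  fixes u :: "real ^ 'n::finite"
  shows "continuous_on A (\<lambda>(s, r). upd i s (upd k r u))"
proof -
  have "continuous_on A (\<lambda>z. if j = i then fst z else if j = k then snd z else u $ j)" for j
    by (cases "j = i"; cases "j = k") (auto intro!: continuous_intros)
  then have "continuous_on A (\<lambda>z. \<chi> j. if j = i then fst z else if j = k then snd z else u $ j)"
    by (rule continuous_on_vec_lambda)
  also have "(\<lambda>z. \<chi> j. if j = i then fst z else if j = k then snd z else u $ j)
      = (\<lambda>(s, r). upd i s (upd k r u))"
    by (auto simp: vec_eq_iff upd_nth fun_eq_iff)
  finally show ?thesis .
qed

lemma cube_mixed_difference_gap:
  fixes F G :: "real ^ 'n::finite \<Rightarrow> real"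
  assumes F: "C2_on_cube U F" and G: "C2_on_cube U G" and "i \<noteq> k"
    and w: "w \<in> cube U" and sub: "{a..b} \<subseteq> U" "{c..d} \<subseteq> U" and le: "a \<le> b" "c \<le> d"
    and gap: "\<And>u. u \<in> cube U \<Longrightarrow>
      \<bar>\<kappa> * partial U k (partial U i F) u - l * partial U i (partial U k G) u\<bar> \<le> e"
  defines "W \<equiv> \<lambda>s r. upd i s (upd k r w)"
  shows "\<bar>\<kappa> * (F (W b d) - F (W a d) - F (W b c) + F (W a c))
      - l * (G (W b d) - G (W a d) - G (W b c) + G (W a c))\<bar> \<le> e * ((b - a) * (d - c))"
proof -
  \<comment> \<open>With coordinate \<open>k\<close> outermost, derivatives in \<open>r\<close>
    become instances of \<open>partial_has_vector_derivative\<close>.\<close>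
  have W': "W s r = upd k r (upd i s w)" for s r
    using \<open>i \<noteq> k\<close> by (simp add: W_def upd_comm)
  have mem: "W s r \<in> cube U" if "s \<in> {a..b}" "r \<in> {c..d}" for s r
    using that sub w by (auto simp: W_def intro!: upd_in_cube)
  have cont: "continuous_on (cbox (a, c) (b, d)) (\<lambda>(s, r). H (W s r))"
    if "continuous_on (cube U) H" for H :: "real ^ 'n \<Rightarrow> real"
  proof -
    have "(\<lambda>(s, r). W s r) ` cbox (a, c) (b, d) \<subseteq> cube U"
      using mem by (auto simp: cbox_Pair_eq)
    from continuous_on_compose2[OF that _ this] show ?thesis
      using continuous_on_upd_upd[of _ i k w] by (simp add: W_def case_prod_unfold)
  qed
  show ?thesis
  proof (rule mixed_difference_gap[where p = "\<lambda>s r. F (W s r)" and q = "\<lambda>s r. G (W s r)"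
      and ps = "\<lambda>s r. partial U i F (W s r)" and psr = "\<lambda>s r. partial U k (partial U i F) (W s r)"
      and qr = "\<lambda>s r. partial U k G (W s r)" and qrs = "\<lambda>s r. partial U i (partial U k G) (W s r)",
      OF le])
    fix s r assume sr: "s \<in> {a..b}" "r \<in> {c..d}"
    note m = mem[OF sr]
    show "((\<lambda>s. F (W s r)) has_vector_derivative partial U i F (W s r)) (at s within {a..b})"
      using F m sub unfolding W_def C2_on_cube_def by (auto intro!: partial_has_vector_derivative)
    show "((\<lambda>s. partial U k G (W s r)) has_vector_derivative partial U i (partial U k G) (W s r))
        (at s within {a..b})"
      using G m sub unfolding W_def C2_on_cube_def by (auto intro!: partial_has_vector_derivative)
    show "((\<lambda>r. G (W s r)) has_vector_derivative partial U k G (W s r)) (at r within {c..d})"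
      using G m sub unfolding W' C2_on_cube_def by (auto intro!: partial_has_vector_derivative)
    show "((\<lambda>r. partial U i F (W s r)) has_vector_derivative partial U k (partial U i F) (W s r))
        (at r within {c..d})"
      using F m sub unfolding W' C2_on_cube_def by (auto intro!: partial_has_vector_derivative)
    show "\<bar>\<kappa> * partial U k (partial U i F) (W s r) - l * partial U i (partial U k G) (W s r)\<bar> \<le> e"
      by (rule gap[OF m])
  qed (use F G in \<open>auto simp: C2_on_cube_def intro!: cont\<close>)
qed

text \<open>Exchanging \<open>a\<close> with \<open>b\<close>, or \<open>c\<close> with
  \<open>d\<close>, flips the sign of both mixed differences and leaves the absolute value
  unchanged. This is needed because the legs of the path start at 0, which may lie on either side of
  the target coordinate.\<close>

lemma cube_mixed_difference_gap_unordered: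
  fixes F G :: "real ^ 'n::finite \<Rightarrow> real"
  assumes F: "C2_on_cube U F" and G: "C2_on_cube U G" and "i \<noteq> k"
    and w: "w \<in> cube U" and U: "U = {lo..hi}" "a \<in> U" "b \<in> U" "c \<in> U" "d \<in> U"
    and gap: "\<And>u. u \<in> cube U \<Longrightarrow>
      \<bar>\<kappa> * partial U k (partial U i F) u - l * partial U i (partial U k G) u\<bar> \<le> e"
  defines "W \<equiv> \<lambda>s r. upd i s (upd k r w)"
  shows "\<bar>\<kappa> * (F (W b d) - F (W a d) - F (W b c) + F (W a c))
      - l * (G (W b d) - G (W a d) - G (W b c) + G (W a c))\<bar> \<le> e * (\<bar>b - a\<bar> * \<bar>d - c\<bar>)"
proof -
  have *: "\<bar>\<kappa> * (F (W b d) - F (W a d) - F (W b c) + F (W a c))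
      - l * (G (W b d) - G (W a d) - G (W b c) + G (W a c))\<bar> \<le> e * ((b - a) * (d - c))"
    if "a \<in> U" "b \<in> U" "c \<in> U" "d \<in> U" "a \<le> b" "c \<le> d" for a b c d
    unfolding W_def
    by (rule cube_mixed_difference_gap[OF F G \<open>i \<noteq> k\<close> w _ _ _ _ gap]) (use U(1) that in auto)
  consider "a \<le> b" "c \<le> d" | "b \<le> a" "c \<le> d" | "a \<le> b" "d \<le> c" | "b \<le> a" "d \<le> c"
    by linarith
  then show ?thesis
  proof cases
    case 1 then show ?thesis using *[of a b c d] U by simp
  next
    case 2 then show ?thesis using *[of b a c d] U by (simp add: algebra_simps)
  next
    case 3 then show ?thesis using *[of a b d c] U by (simp add: algebra_simps)
  next
    case 4 then show ?thesis using *[of b a d c] U by (simp add: algebra_simps)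
  qed
qed

subsection \<open>An approximate potential\<close>

definition cut :: "('n \<Rightarrow> nat) \<Rightarrow> nat \<Rightarrow> real ^ 'n \<Rightarrow> real ^ 'n" where
  "cut \<rho> m u = (\<chi> j. if \<rho> j < m then u $ j else 0)"

text \<open>For injective \<open>\<rho>\<close> the two points differ at most in coordinate
  \<open>k\<close>. The difference is thus the integral of the \<open>k\<close>-th partial
  derivative over that leg of the path, written without an integral.\<close>

definition increment :: "('n \<Rightarrow> nat) \<Rightarrow> 'n \<Rightarrow> (real ^ 'n \<Rightarrow> real) \<Rightarrow> real ^ 'n \<Rightarrow> real" where
  "increment \<rho> k F u = F (cut \<rho> (Suc (\<rho> k)) u) - F (cut \<rho> (\<rho> k) u)"

text \<open>The sum is the integral of the form \<open>\<Sum>k. \<partial>\<^sub>kF\<^sub>k du\<^sub>k\<close> along the path from \<open>0\<close> to \<open>u\<close> that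
  switches on the coordinates one after the other, in the order of the ranks \<open>\<rho>\<close>.\<close>

definition path_potential ::
    "('n::finite \<Rightarrow> nat) \<Rightarrow> ('n \<Rightarrow> real ^ 'n \<Rightarrow> real) \<Rightarrow> real ^ 'n \<Rightarrow> real" where
  "path_potential \<rho> F u = (\<Sum>k\<in>UNIV. increment \<rho> k (F k) u)"

lemma cut_nth: "cut \<rho> m u $ j = (if \<rho> j < m then u $ j else 0)"
  by (simp add: cut_def)

lemma cut_in_cube: "u \<in> cube U \<Longrightarrow> 0 \<in> U \<Longrightarrow> cut \<rho> m u \<in> cube U"
  by (simp add: cube_def cut_nth)

lemma continuous_on_cut: "continuous_on A (cut \<rho> m)"
proof -
  have "continuous_on A (\<lambda>u. if \<rho> j < m then u $ j else 0)" for j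
    by (cases "\<rho> j < m") (auto intro!: continuous_intros)
  then show ?thesis
    unfolding cut_def[abs_def] by (rule continuous_on_vec_lambda)
qed

lemma continuous_on_path_potential:
  fixes F :: "'n::finite \<Rightarrow> real ^ 'n \<Rightarrow> real"
  assumes "\<And>k. continuous_on (cube U) (F k)" "0 \<in> U"
  shows "continuous_on (cube U) (path_potential \<rho> F)"
proof -
  have "continuous_on (cube U) (\<lambda>u. F k (cut \<rho> m u))" for k m
    by (rule continuous_on_compose2[OF assms(1) continuous_on_cut])
      (use assms(2) in \<open>auto intro: cut_in_cube\<close>)
  then show ?thesis
    unfolding path_potential_def increment_def by (intro continuous_intros)
qed

text \<open>The sum telescopes along the path. A single function is thereby split over the same legs
  as the potential, which permits a comparison leg by leg.\<close>

lemma sum_increment: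
  fixes F :: "real ^ 'n::finite \<Rightarrow> real"
  assumes \<rho>: "bij_betw \<rho> UNIV {..<CARD('n)}"
  shows "(\<Sum>k\<in>UNIV. increment \<rho> k F u) = F u - F 0"
proof -
  have "(\<Sum>k\<in>UNIV. increment \<rho> k F u) = (\<Sum>m<CARD('n). F (cut \<rho> (Suc m) u) - F (cut \<rho> m u))"
    unfolding increment_def using \<rho> by (rule sum.reindex_bij_betw)
  also have "\<dots> = F (cut \<rho> CARD('n) u) - F (cut \<rho> 0 u)"
    by (rule sum_lessThan_telescope)
  also have "cut \<rho> CARD('n) u = u"
    using bij_betw_apply[OF \<rho>] by (simp add: vec_eq_iff cut_nth)
  also have "cut \<rho> 0 u = 0"
    by (simp add: vec_eq_iff cut_nth)
  finally show ?thesis .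
qed

text \<open>Coordinate \<open>i\<close> is still switched off at both ends of leg \<open>k\<close>;
  the far end has stage \<open>Suc (\<rho> k)\<close>, which is at most
  \<open>\<rho> i\<close>.\<close>

lemma increment_upd_lower:
  assumes "\<rho> k < \<rho> i"
  shows "increment \<rho> k F (upd i a u) = increment \<rho> k F u"
proof -
  have "cut \<rho> m (upd i a u) = cut \<rho> m u" if "m \<le> \<rho> i" for m
    using that by (auto simp: vec_eq_iff cut_nth upd_nth)
  then show ?thesis using assms by (simp add: increment_def)
qed

text \<open>Here coordinate \<open>i\<close> is already switched on. The form of the right-hand side
  exhibits the ends of the leg as corners of a rectangle in the coordinates \<open>i\<close> and
  \<open>k\<close>.\<close>

lemma increment_upd_upper:
  assumes "inj \<rho>" "\<rho> i < \<rho> k"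
  shows "increment \<rho> k F (upd i a u)
    = F (upd i a (upd k (u $ k) (cut \<rho> (\<rho> k) u))) - F (upd i a (upd k 0 (cut \<rho> (\<rho> k) u)))"
proof -
  have eq: "\<rho> j = \<rho> k \<longleftrightarrow> j = k" for j using assms(1) by (auto dest: injD)
  have "cut \<rho> (Suc (\<rho> k)) (upd i a u) = upd i a (upd k (u $ k) (cut \<rho> (\<rho> k) u))"
    using assms(2) by (auto simp: vec_eq_iff cut_nth upd_nth less_Suc_eq eq)
  moreover have "cut \<rho> (\<rho> k) (upd i a u) = upd i a (upd k 0 (cut \<rho> (\<rho> k) u))"
    using assms(2) by (auto simp: vec_eq_iff cut_nth upd_nth)
  ultimately show ?thesis by (simp add: increment_def)
qed

text \<open>By telescoping, \<open>R\<close> is, up to a constant, a sum over legs of increments of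
  \<open>c k * F k - c i * F i\<close>. Leg \<open>i\<close> contributes 0, legs before it do not
  see coordinate \<open>i\<close>, and each later leg contributes a difference of mixed second
  differences controlled by the gap.\<close>

lemma path_potential_oscillation:
  fixes F :: "'n::finite \<Rightarrow> real ^ 'n \<Rightarrow> real" and c :: "'n \<Rightarrow> real" and i :: 'n
  assumes \<rho>: "bij_betw \<rho> UNIV {..<CARD('n)}"
    and F: "\<And>i. C2_on_cube U (F i)"
    and U: "U = {lo..hi}" "0 \<in> U" "a \<in> U" "b \<in> U" and u: "u \<in> cube U"
    and gap: "\<And>i j u. i \<noteq> j \<Longrightarrow> u \<in> cube U \<Longrightarrow>
      \<bar>c i * partial U j (partial U i (F i)) u - c j * partial U i (partial U j (F j)) u\<bar> \<le> e"
  defines "R \<equiv> \<lambda>u. path_potential \<rho> (\<lambda>k u. c k * F k u) u - c i * F i u"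
  shows "\<bar>R (upd i b u) - R (upd i a u)\<bar> \<le> (real CARD('n) - 1) * e * (hi - lo)\<^sup>2"
proof -
  define E where "E k u = increment \<rho> k (\<lambda>u. c k * F k u) u - increment \<rho> k (\<lambda>u. c i * F i u) u" for k u
  have inj: "inj \<rho>" using \<rho> by (simp add: bij_betw_def)
  have R: "R u = (\<Sum>k\<in>UNIV. E k u) - c i * F i 0" for u
    using sum_increment[OF \<rho>, of "\<lambda>u. c i * F i u" u]
    by (simp add: R_def E_def path_potential_def sum_subtractf)
  have bound: "\<bar>E k (upd i b u) - E k (upd i a u)\<bar> \<le> e * (hi - lo)\<^sup>2" if "k \<noteq> i" for k
  proof -
    have e: "0 \<le> e" using gap[OF that u] by linarith
    have "\<rho> k \<noteq> \<rho> i" using inj that by (auto dest: injD)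
    then consider "\<rho> k < \<rho> i" | "\<rho> i < \<rho> k" by linarith
    then show ?thesis
    proof cases
      case 1
      then show ?thesis using e by (simp add: E_def increment_upd_lower)
    next
      case 2
      have uk: "u $ k \<in> U" using u by (simp add: cube_def)
      have "\<bar>c i * (F i (upd i b (upd k (u $ k) (cut \<rho> (\<rho> k) u)))
             - F i (upd i a (upd k (u $ k) (cut \<rho> (\<rho> k) u)))
             - F i (upd i b (upd k 0 (cut \<rho> (\<rho> k) u))) + F i (upd i a (upd k 0 (cut \<rho> (\<rho> k) u))))
          - c k * (F k (upd i b (upd k (u $ k) (cut \<rho> (\<rho> k) u)))
             - F k (upd i a (upd k (u $ k) (cut \<rho> (\<rho> k) u)))
             - F k (upd i b (upd k 0 (cut \<rho> (\<rho> k) u))) + F k (upd i a (upd k 0 (cut \<rho> (\<rho> k) u))))\<bar>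
          \<le> e * (\<bar>b - a\<bar> * \<bar>u $ k - 0\<bar>)"
        by (rule cube_mixed_difference_gap_unordered[OF F F])
          (use that u uk U gap in \<open>auto intro!: cut_in_cube\<close>)
      \<comment> \<open>The points \<open>a\<close>, \<open>b\<close>, \<open>u $ k\<close> and 0
        all lie in \<open>U\<close>, so each side of the rectangle is at most
        \<open>hi - lo\<close>.\<close>
      also have "\<dots> \<le> e * (hi - lo)\<^sup>2"
        unfolding power2_eq_square
        by (intro mult_left_mono mult_mono e) (use uk U in auto)
      finally show ?thesis
        by (simp add: E_def increment_upd_upper[OF inj 2] algebra_simps)
    qed
  qed
  have "R (upd i b u) - R (upd i a u) = (\<Sum>k\<in>UNIV. E k (upd i b u) - E k (upd i a u))"
    by (simp add: R sum_subtractf)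
  also have "\<dots> = (\<Sum>k\<in>UNIV - {i}. E k (upd i b u) - E k (upd i a u))"
    by (rule sum.mono_neutral_right) (auto simp: E_def)
  finally have "\<bar>R (upd i b u) - R (upd i a u)\<bar> \<le> (\<Sum>k\<in>UNIV - {i}. \<bar>E k (upd i b u) - E k (upd i a u)\<bar>)"
    by simp
  also have "\<dots> \<le> real (card (UNIV - {i})) * (e * (hi - lo)\<^sup>2)"
    by (rule sum_bounded_above) (use bound in auto)
  also have "real (card (UNIV - {i})) = real CARD('n) - 1"
    by (simp add: card_Diff_subset of_nat_diff Suc_leI)
  finally show ?thesis by (simp add: mult.assoc)
qed

subsection \<open>The game\<close>

lemma cube_Icc: "cube {lo..hi} = cbox (\<chi> i. lo) (\<chi> i. hi)"
  by (auto simp: cube_def mem_box_cart)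

lemma measure_cube_pos:
  assumes "lo < hi"
  shows "0 < measure lborel (cube {lo..hi} :: (real ^ 'n::finite) set)"
  using assms unfolding cube_Icc by (subst content_cbox_if_cart) (auto simp: interval_eq_empty_cart)

lemma profile_in_cube: "v \<in> opponents U i \<Longrightarrow> a \<in> U \<Longrightarrow> profile i a v \<in> cube U"
  by (auto simp: cube_def profile_def opponents_def PiE_mem)

text \<open>At coordinate \<open>i\<close> both sides are \<open>undefined\<close>: the left by
  \<open>restrict\<close>, the right by extensionality of \<open>v\<close>.\<close>

lemma others_profile: "v \<in> opponents U i \<Longrightarrow> others i (profile i a v) = v"
  using PiE_arb[of v "- {i}" "\<lambda>_. U" i]
  by (auto simp: fun_eq_iff others_def profile_def opponents_def restrict_def)

lemma upd_profile: "v \<in> opponents U i \<Longrightarrow> upd i a (profile i z v) = profile i a v"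
  by (simp add: upd_def others_profile)

lemma continuous_on_profile:
  fixes F :: "real ^ 'n::finite \<Rightarrow> real"
  assumes "continuous_on (cube U) F" "v \<in> opponents U i"
  shows "continuous_on U (\<lambda>a. F (profile i a v))"
proof -
  have "continuous_on U (\<lambda>a. if j = i then a else v j)" for j
    by (cases "j = i") (auto intro!: continuous_intros)
  then have "continuous_on U (\<lambda>a. profile i a v)"
    unfolding profile_def by (rule continuous_on_vec_lambda)
  then show ?thesis
    by (rule continuous_on_compose2[OF assms(1)]) (auto intro: profile_in_cube assms(2))
qed

lemma cond_density_gibbs:
  assumes "(LINT z:cube U|lborel. exp (\<Phi> z)) \<noteq> 0"
  shows "cond_density U (gibbs (cube U) \<Phi>) i v = gibbs U (\<lambda>a. \<Phi> (profile i a v))"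
  using assms by (simp add: fun_eq_iff cond_density_def gibbs_def)

text \<open>By \<open>others_profile\<close>, \<open>q_star\<close> uses the same value function
  \<open>V i v\<close> for every own action \<open>a\<close>, so the terms added to the Hamiltonian
  are constant in \<open>a\<close> and normalisation removes them.\<close>

lemma gibbs_response_eq_gibbs_q_star:
  assumes "v \<in> opponents U i"
  shows "gibbs_response U b \<sigma> f \<gamma> V i t x v
    = gibbs U (\<lambda>a. 1 / \<gamma> i * q_star T b \<sigma> f \<beta> V i t x (profile i a v))"
proof -
  define W where "W = V i v"
  define h where "h a = hamiltonian b \<sigma> f i t x (profile i a v) (space_grad W t x) (space_hess W t x)" for a
  have "gibbs_response U b \<sigma> f \<gamma> V i t x v = gibbs U (\<lambda>a. h a / \<gamma> i)"
    by (simp add: fun_eq_iff gibbs_response_def gibbs_def h_def W_def)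
  also have "\<dots> = gibbs U (\<lambda>a. h a / \<gamma> i + (time_deriv T W t x - \<beta> i * W t x) / \<gamma> i)"
    by (rule gibbs_add_const[symmetric])
  also have "\<dots> = gibbs U (\<lambda>a. 1 / \<gamma> i * q_star T b \<sigma> f \<beta> V i t x (profile i a v))"
    using assms
    by (simp add: q_star_def others_profile Let_def h_def W_def add_divide_distrib diff_divide_distrib algebra_simps)
  finally show ?thesis .
qed

text \<open>From \<open>exp x \<le> 1 + x + x^2\<close> and \<open>x^2 \<le> x\<close> on the unit
  interval.\<close>

lemma exp_minus_one_le_double:
  fixes x :: real
  assumes "0 \<le> x" "x \<le> 1"
  shows "exp x - 1 \<le> 2 * x"
  using exp_bound[OF assms] mult_left_le[OF assms(2,1)] by (simp add: power2_eq_square)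

theorem theorem21:
  fixes T \<epsilon> \<delta> :: real
    and U :: "real set"
    and b \<sigma> :: "'n::finite \<Rightarrow> real \<Rightarrow> real ^ 'n \<Rightarrow> real ^ 'n \<Rightarrow> real"
    and f :: "'n \<Rightarrow> real \<Rightarrow> real ^ 'n \<Rightarrow> real \<Rightarrow> real"
    and g :: "'n \<Rightarrow> real ^ 'n \<Rightarrow> real"
    and \<beta> \<gamma> :: "'n \<Rightarrow> real"
    and V :: "'n \<Rightarrow> ('n \<Rightarrow> real) \<Rightarrow> real \<Rightarrow> real ^ 'n \<Rightarrow> real"
  assumes T: "0 < T"
    and U: "compact U" "convex U" "0 \<in> U" "0 < measure lborel U"
    and data: "measurable_data T U b \<sigma> f g"
    and \<beta>: "\<And>i. 0 \<le> \<beta> i"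
    and \<gamma>: "\<And>i. 0 < \<gamma> i"
    and V: "\<And>i v. v \<in> opponents U i \<Longrightarrow> classical_HJB_solution T U b \<sigma> f g \<beta> \<gamma> i v (V i v)"
    and q: "\<And>i t x. t \<in> {0..T} \<Longrightarrow> C2_on_cube U (q_star T b \<sigma> f \<beta> V i t x)"
    and gap: "\<And>i j. i \<noteq> j \<Longrightarrow>
      (SUP (t, x, u) \<in> {0..T} \<times> UNIV \<times> cube U.
         ereal \<bar>compat_gap T U b \<sigma> f \<beta> \<gamma> V i j t x u\<bar>) \<le> ereal \<epsilon>"
    and \<delta>: "\<delta> = 2 * (real CARD('n) - 1) * \<epsilon> * (measure lborel U)\<^sup>2"
  shows "\<exists>\<psi> :: real \<Rightarrow> real ^ 'n \<Rightarrow> real ^ 'n \<Rightarrow> real.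
    (\<forall>t\<in>{0..T}. \<forall>x.
       prob_density_on (cube U) (\<psi> t x) \<and>
       (\<forall>i. \<forall>v\<in>opponents U i.
          prob_density_on U (cond_density U (\<psi> t x) i v) \<and>
          KL_density U (cond_density U (\<psi> t x) i v) (gibbs_response U b \<sigma> f \<gamma> V i t x v)
            \<le> ereal ((exp \<delta> - 1)\<^sup>2) \<and>
          (\<delta> \<le> 1 \<longrightarrow>
             KL_density U (cond_density U (\<psi> t x) i v) (gibbs_response U b \<sigma> f \<gamma> V i t x v)
               \<le> ereal (16 * (real CARD('n) - 1)\<^sup>2 * \<epsilon>\<^sup>2 * measure lborel U ^ 4)))) \<and>
    (2 \<le> CARD('n) \<longrightarrow>
       (\<delta> \<le> 1 \<longleftrightarrow> \<epsilon> \<le> 1 / (2 * (real CARD('n) - 1) * (measure lborel U)\<^sup>2))) \<and>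
    (\<forall>i. local_loss T U b \<sigma> f \<gamma> V \<psi> i \<le> ereal (\<gamma> i * (exp \<delta> - 1)\<^sup>2) \<and>
         (\<delta> \<le> 1 \<longrightarrow>
            local_loss T U b \<sigma> f \<gamma> V \<psi> i
              \<le> ereal (16 * \<gamma> i * (real CARD('n) - 1)\<^sup>2 * \<epsilon>\<^sup>2 * measure lborel U ^ 4))) \<and>
    (\<epsilon> = 0 \<longrightarrow>
       (\<forall>t\<in>{0..T}. \<forall>x. \<forall>i. \<forall>v\<in>opponents U i. \<forall>a\<in>U.
          cond_density U (\<psi> t x) i v a = gibbs_response U b \<sigma> f \<gamma> V i t x v a))"
proof -
  let ?N = "real CARD('n)" and ?L = "measure lborel U"
  obtain lo hi where Uc: "U = {lo..hi}"
    using U(1,2) convex_connected connected_compact_interval_1 by metis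
  have "lo \<le> hi" using U(3) by (simp add: Uc)
  then have lohi: "lo < hi" "?L = hi - lo"
    using U(4) by (simp_all add: Uc content_real)
  \<comment> \<open>Any enumeration of the players fixes an order for the path.\<close>
  obtain \<rho> :: "'n \<Rightarrow> nat" where \<rho>: "bij_betw \<rho> UNIV {..<CARD('n)}"
    using ex_bij_betw_finite_nat[of "UNIV :: 'n set"] by (auto simp: atLeast0LessThan)
  have gapD: "\<bar>compat_gap T U b \<sigma> f \<beta> \<gamma> V i j t x u\<bar> \<le> \<epsilon>"
    if "i \<noteq> j" "t \<in> {0..T}" "u \<in> cube U" for i j t x u
  proof -
    have "ereal \<bar>compat_gap T U b \<sigma> f \<beta> \<gamma> V i j t x u\<bar> \<le> ereal \<epsilon>"
      by (rule order_trans[OF _ gap[OF that(1)]], rule SUP_upper2[of "(t, x, u)"]) (use that in auto)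
    then show ?thesis by simp
  qed
  define D where "D = (?N - 1) * \<epsilon> * ?L\<^sup>2"
  have \<delta>D: "\<delta> = 2 * D" by (simp add: \<delta> D_def)
  \<comment> \<open>For one player the factor \<open>?N - 1\<close> vanishes, whatever the sign of
    \<open>\<epsilon>\<close>. Otherwise a pair \<open>i \<noteq> j\<close> exists and the gap bound
    at a single point gives \<open>0 \<le> \<epsilon>\<close>.\<close>
  have D0: "0 \<le> D"
  proof (cases "CARD('n) = 1")
    case True
    then show ?thesis by (simp add: D_def)
  next
    case False
    moreover have "0 < CARD('n)" by simp
    ultimately have "\<not> CARD('n) \<le> Suc 0" by linarith
    then obtain i j :: 'n where "i \<noteq> j"
      by (auto simp: card_le_Suc0_iff_eq)
    moreover have "0 \<in> cube U" using U(3) by (simp add: cube_def)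
    ultimately have "0 \<le> \<epsilon>" using gapD[of i j 0 0] T by fastforce
    then show ?thesis by (simp add: D_def Suc_leI)
  qed
  define q where "q t x i = q_star T b \<sigma> f \<beta> V i t x" for t x i
  define \<Phi> where "\<Phi> t x = path_potential \<rho> (\<lambda>k u. 1 / \<gamma> k * q t x k u)" for t x
  define \<psi> where "\<psi> t x = gibbs (cube U) (\<Phi> t x)" for t x
  have cube: "compact (cube U :: (real ^ 'n) set)" "0 < measure lborel (cube U :: (real ^ 'n) set)"
    using lohi measure_cube_pos unfolding Uc by (auto simp: cube_Icc)
  have qC2: "C2_on_cube U (q t x i)" if "t \<in> {0..T}" for t x i
    using q[OF that] by (simp add: q_def)
  have qcont: "continuous_on (cube U) (\<lambda>u. 1 / \<gamma> i * q t x i u)" if "t \<in> {0..T}" for t x i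
    using qC2[OF that] \<gamma>[of i] by (auto simp: C2_on_cube_def intro!: continuous_intros)
  have \<Phi>cont: "continuous_on (cube U) (\<Phi> t x)" if "t \<in> {0..T}" for t x
    unfolding \<Phi>_def by (rule continuous_on_path_potential) (use qcont that U in auto)
  have cond: "cond_density U (\<psi> t x) i v = gibbs U (\<lambda>a. \<Phi> t x (profile i a v))"
    if "t \<in> {0..T}" for t x i v
    unfolding \<psi>_def
    by (rule cond_density_gibbs) (use partition_function_pos[OF cube \<Phi>cont[OF that, of x]] in simp)
  have resp: "gibbs_response U b \<sigma> f \<gamma> V i t x v = gibbs U (\<lambda>a. 1 / \<gamma> i * q t x i (profile i a v))"
    if "v \<in> opponents U i" for t x i v
    unfolding q_def by (rule gibbs_response_eq_gibbs_q_star[OF that])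
  \<comment> \<open>The oscillation lemma is used at the profile \<open>profile i a v\<close>, whose
    updates in coordinate \<open>i\<close> are the two profiles compared here.\<close>
  have osc: "\<bar>(\<Phi> t x (profile i a v) - 1 / \<gamma> i * q t x i (profile i a v))
      - (\<Phi> t x (profile i z v) - 1 / \<gamma> i * q t x i (profile i z v))\<bar> \<le> D"
    if "t \<in> {0..T}" "v \<in> opponents U i" "a \<in> U" "z \<in> U" for t x i v a z
    using path_potential_oscillation[where F = "q t x" and c = "\<lambda>i. 1 / \<gamma> i" and i = i and e = \<epsilon>,
        OF \<rho> qC2[OF that(1)] Uc U(3) that(4,3) profile_in_cube[OF that(2,3)]]
      gapD that
    by (simp add: \<Phi>_def D_def lohi(2) upd_profile[OF that(2)] q_def compat_gap_def)
  note conts = continuous_on_profile[OF \<Phi>cont] continuous_on_profile[OF qcont]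
  have KLD: "KL_density U (cond_density U (\<psi> t x) i v) (gibbs_response U b \<sigma> f \<gamma> V i t x v)
      \<le> ereal ((exp D - 1)\<^sup>2)" if "t \<in> {0..T}" "v \<in> opponents U i" for t x i v
    unfolding cond[OF that(1)] resp[OF that(2)]
    by (rule KL_gibbs_le[OF U(1,4)]) (use conts osc that in auto)
  \<comment> \<open>The estimate obtained with \<open>D\<close> is weakened to
    \<open>\<delta> = 2 * D\<close>, which is monotone because \<open>0 \<le> D\<close>.\<close>
  have "(exp D - 1)\<^sup>2 \<le> (exp \<delta> - 1)\<^sup>2"
    using D0 by (intro power_mono) (auto simp: \<delta>D)
  then have KL: "KL_density U (cond_density U (\<psi> t x) i v) (gibbs_response U b \<sigma> f \<gamma> V i t x v)
      \<le> ereal ((exp \<delta> - 1)\<^sup>2)" if "t \<in> {0..T}" "v \<in> opponents U i" for t x i v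
    using KLD[OF that] by (meson ereal_less_eq(3) order_trans)
  have small: "(exp \<delta> - 1)\<^sup>2 \<le> 16 * (?N - 1)\<^sup>2 * \<epsilon>\<^sup>2 * ?L ^ 4" if "\<delta> \<le> 1"
  proof -
    have "(exp \<delta> - 1)\<^sup>2 \<le> (2 * \<delta>)\<^sup>2"
      using D0 that exp_minus_one_le_double[of \<delta>] by (intro power_mono) (auto simp: \<delta>D)
    also have "\<dots> = 16 * (?N - 1)\<^sup>2 * \<epsilon>\<^sup>2 * ?L ^ 4"
      by (simp add: \<delta> power2_eq_square power4_eq_xxxx algebra_simps)
    finally show ?thesis .
  qed
  \<comment> \<open>A general constant \<open>C\<close> covers both loss bounds. The product stays
    in \<open>ereal\<close>, so the supremum is bounded by monotonicity of multiplication by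
    \<open>\<gamma> i\<close>.\<close>
  have loss: "local_loss T U b \<sigma> f \<gamma> V \<psi> i \<le> ereal (\<gamma> i * C)" if "(exp \<delta> - 1)\<^sup>2 \<le> C" for i C
    unfolding local_loss_def
  proof (rule SUP_least, clarsimp simp flip: times_ereal.simps(1))
    fix t x v assume *: "0 \<le> t" "t \<le> T" "v \<in> opponents U i"
    have "KL_density U (cond_density U (\<psi> t x) i v) (gibbs_response U b \<sigma> f \<gamma> V i t x v) \<le> ereal C"
      using KL[of t v i x] * that by (meson atLeastAtMost_iff ereal_less_eq(3) order_trans)
    then show "ereal (\<gamma> i) * KL_density U (cond_density U (\<psi> t x) i v) (gibbs_response U b \<sigma> f \<gamma> V i t x v)
        \<le> ereal (\<gamma> i) * ereal C"
      using \<gamma>[of i] by (intro ereal_mult_left_mono) auto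
  qed
  show ?thesis
  proof (intro exI[of _ \<psi>] conjI ballI allI impI)
    fix t x assume t: "t \<in> {0..T}"
    show "prob_density_on (cube U) (\<psi> t x)"
      unfolding \<psi>_def by (rule prob_density_on_gibbs[OF cube \<Phi>cont[OF t]])
    fix i :: 'n and v assume v: "v \<in> opponents U i"
    show "prob_density_on U (cond_density U (\<psi> t x) i v)"
      unfolding cond[OF t] by (rule prob_density_on_gibbs[OF U(1,4) conts(1)[OF t v]])
    show KL': "KL_density U (cond_density U (\<psi> t x) i v) (gibbs_response U b \<sigma> f \<gamma> V i t x v)
        \<le> ereal ((exp \<delta> - 1)\<^sup>2)"
      by (rule KL[OF t v])
    show "KL_density U (cond_density U (\<psi> t x) i v) (gibbs_response U b \<sigma> f \<gamma> V i t x v)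
        \<le> ereal (16 * (?N - 1)\<^sup>2 * \<epsilon>\<^sup>2 * ?L ^ 4)" if "\<delta> \<le> 1"
      using KL' small[OF that] by (meson ereal_less_eq(3) order_trans)
    show "cond_density U (\<psi> t x) i v a = gibbs_response U b \<sigma> f \<gamma> V i t x v a"
      if "\<epsilon> = 0" "a \<in> U" for a
    proof -
      have "D = 0" using that by (simp add: D_def)
      then have 0: "\<bar>(\<Phi> t x (profile i a v) - 1 / \<gamma> i * q t x i (profile i a v))
        - (\<Phi> t x (profile i z v) - 1 / \<gamma> i * q t x i (profile i z v))\<bar> \<le> 0" if "z \<in> U" for z
        using osc[OF t v \<open>a \<in> U\<close> that] by simp
      show ?thesis
        unfolding cond[OF t] resp[OF v]
      \<comment> \<open>With \<open>D = 0\<close> the comparison factor is 1, and the two directions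
        of \<open>gibbs_le_gibbs\<close> give equality at every point of \<open>U\<close>.\<close>
      proof (rule antisym)
        show "gibbs U (\<lambda>a. \<Phi> t x (profile i a v)) a \<le> gibbs U (\<lambda>a. 1 / \<gamma> i * q t x i (profile i a v)) a"
          by (rule gibbs_le_gibbs[OF U(1,4) conts[OF t v], where D = 0, simplified exp_zero mult_1_left])
            (use 0 in fastforce)
        show "gibbs U (\<lambda>a. 1 / \<gamma> i * q t x i (profile i a v)) a \<le> gibbs U (\<lambda>a. \<Phi> t x (profile i a v)) a"
          by (rule gibbs_le_gibbs[OF U(1,4) conts(2,1)[OF t v], where D = 0, simplified exp_zero mult_1_left])
            (use 0 in fastforce)
      qed
    qed
  next
    assume "2 \<le> CARD('n)"
    then have "0 < 2 * (?N - 1) * ?L\<^sup>2" using U(4) by simp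
    then show "\<delta> \<le> 1 \<longleftrightarrow> \<epsilon> \<le> 1 / (2 * (?N - 1) * ?L\<^sup>2)"
      by (simp add: \<delta> field_simps)
  next
    fix i :: 'n
    show "local_loss T U b \<sigma> f \<gamma> V \<psi> i \<le> ereal (\<gamma> i * (exp \<delta> - 1)\<^sup>2)"
      by (rule loss) simp
    show "local_loss T U b \<sigma> f \<gamma> V \<psi> i \<le> ereal (16 * \<gamma> i * (?N - 1)\<^sup>2 * \<epsilon>\<^sup>2 * ?L ^ 4)" if "\<delta> \<le> 1"
      using loss[OF small[OF that], of i] by (simp add: mult_ac)
  qed
qed

end
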